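(* Fix positive integers $p,q$ such that either (i) $q\geq 2$ and $p>q(3q-2)/(2q-2)$, or (ii) $q=1$ and $p\geq 3$. Let $\mathcal{L}$ denote the equation $px+qy=z$. Then $$f(n,\mathcal{L})=\Theta(2^{\mu_{\mathcal{L}}(n)}).$$
   Context: $[n]=\{1,\dots,n\}$. A set $A\subseteq[n]$ is $\mathcal{L}$-free, for $\mathcal{L}$ the equation $px+qy=z$ with $p,q$ as in the statement, if there are no $x,y,z\in A$ (not necessarily distinct) with $px+qy=z$ (such an equation has no trivial solutions). $\mu_{\mathcal{L}}(n)$ denotes the size of the largest $\mathcal{L}$-free subset of $[n]$, and $f(n,\mathcal{L})$ denotes the number of $\mathcal{L}$-free subsets of $[n]$. The asymptotic notation is for $n\to\infty$ with $p,q$ fixed; the implied constants may depend on $p,q$. *)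

theory Defs
  imports "HOL-Library.Landau_Symbols"
begin

definition lin_free :: "nat \<Rightarrow> nat \<Rightarrow> nat set \<Rightarrow> bool" where
  "lin_free p q A \<longleftrightarrow> \<not> (\<exists>x\<in>A. \<exists>y\<in>A. \<exists>z\<in>A. p * x + q * y = z)"

definition free_subsets :: "nat \<Rightarrow> nat \<Rightarrow> nat \<Rightarrow> nat set set" where
  "free_subsets p q n = {A. A \<subseteq> {1..n} \<and> lin_free p q A}"

text \<open>The maximum below is well defined: \<open>free_subsets p q n\<close> is finite and contains the empty set.\<close>

definition mu_free :: "nat \<Rightarrow> nat \<Rightarrow> nat \<Rightarrow> nat" where
  "mu_free p q n = Max (card ` free_subsets p q n)"

definition num_free :: "nat \<Rightarrow> nat \<Rightarrow> nat \<Rightarrow> nat" where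
  "num_free p q n = card (free_subsets p q n)"

end

theory Submission
  imports Defs
begin

text \<open>The interval above \<open>n div (p + q)\<close> is solution-free, so it suffices to bound the number of
  solution-free sets by a constant times \<open>2 ^ (n - n div (p + q))\<close>. Split these sets according to their
  least element \<open>m\<close>. Those with \<open>m > n div (p + q)\<close> are subsets of that interval. For smaller \<open>m\<close>, the
  rest of the set contains no pair \<open>y, \<phi> y\<close> with \<open>\<phi> y = q * y + p * m\<close>, so it is an independent set in
  a disjoint union of paths. Building the paths upwards, a vertex multiplies the number of
  independent sets by \<open>2\<close> if it starts a path, by \<open>3/2\<close> if it comes second, and by at most \<open>5/3\<close>
  afterwards. The resulting bound decays geometrically in \<open>n div (p + q) - m\<close> exactly when
  \<open>q\<^sup>2 ln 2 < (p + q) (q ln (4/3) - ln (10/9))\<close>, which the hypothesis on \<open>p\<close> and \<open>q\<close> guarantees.\<close>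

section \<open>Independent sets of the graph of a map\<close>

definition indep_sets :: "('a \<Rightarrow> 'a) \<Rightarrow> 'a set \<Rightarrow> 'a set set" where
  "indep_sets \<phi> V = {S. S \<subseteq> V \<and> (\<forall>y\<in>S. \<phi> y \<notin> S)}"

lemma finite_indep_sets [simp]: "finite V \<Longrightarrow> finite (indep_sets \<phi> V)"
  by (rule finite_subset[of _ "Pow V"]) (auto simp: indep_sets_def)

text \<open>Split by membership of \<open>y\<close>. As \<open>\<phi> y\<close> lies outside
  \<open>insert y W\<close>, only the preimages of \<open>y\<close> conflict with
  \<open>y\<close>.\<close>

lemma card_indep_sets_insert:
  assumes "finite W" "y \<notin> W" "\<phi> y \<notin> insert y W"
  shows "card (indep_sets \<phi> (insert y W)) =
           card (indep_sets \<phi> W) + card (indep_sets \<phi> (W - {z. \<phi> z = y}))"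
proof -
  have eq: "indep_sets \<phi> (insert y W) =
              indep_sets \<phi> W \<union> insert y ` indep_sets \<phi> (W - {z. \<phi> z = y})"
    (is "?L = ?R")
  proof
    show "?L \<subseteq> ?R"
    proof
      fix S assume S: "S \<in> ?L"
      show "S \<in> ?R"
      proof (cases "y \<in> S")
        case True
        then have "S = insert y (S - {y})" by auto
        moreover have "S - {y} \<in> indep_sets \<phi> (W - {z. \<phi> z = y})"
          using S True by (auto simp: indep_sets_def)
        ultimately show ?thesis by blast
      next
        case False
        then show ?thesis using S by (auto simp: indep_sets_def)
      qed
    qed
    show "?R \<subseteq> ?L"
      using assms by (auto simp: indep_sets_def)
  qed
  have inj: "inj_on (insert y) (indep_sets \<phi> (W - {z. \<phi> z = y}))"
    using assms(2) by (auto simp: inj_on_def indep_sets_def)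
  have "indep_sets \<phi> W \<inter> insert y ` indep_sets \<phi> (W - {z. \<phi> z = y}) = {}"
    using assms(2) by (auto simp: indep_sets_def)
  then show ?thesis
    unfolding eq using assms(1) by (simp add: card_Un_disjoint card_image[OF inj])
qed

text \<open>Removing \<open>y\<close> sends independent sets to independent sets, and at most two
  sets have the same image.\<close>

lemma card_indep_sets_insert_le:
  assumes "finite W"
  shows "card (indep_sets \<phi> (insert y W)) \<le> 2 * card (indep_sets \<phi> W)"
proof -
  have "S \<in> indep_sets \<phi> W \<union> insert y ` indep_sets \<phi> W"
    if "S \<in> indep_sets \<phi> (insert y W)" for S
  proof (cases "y \<in> S")
    case True
    then have "S = insert y (S - {y})" by auto
    moreover have "S - {y} \<in> indep_sets \<phi> W"
      using that by (auto simp: indep_sets_def)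
    ultimately show ?thesis by blast
  next
    case False
    then show ?thesis using that by (auto simp: indep_sets_def)
  qed
  then have "card (indep_sets \<phi> (insert y W)) \<le>
               card (indep_sets \<phi> W \<union> insert y ` indep_sets \<phi> W)"
    using assms by (intro card_mono) auto
  also have "\<dots> \<le> card (indep_sets \<phi> W) + card (insert y ` indep_sets \<phi> W)"
    by (rule card_Un_le)
  also have "\<dots> \<le> 2 * card (indep_sets \<phi> W)"
    using card_image_le[OF finite_indep_sets[OF assms], of "insert y" \<phi>] by simp
  finally show ?thesis .
qed

text \<open>Here \<open>y\<close> is isolated in \<open>V\<close>, so it can be added to or dropped
  from any independent set freely.\<close>

lemma card_indep_sets_remove_root:
  assumes "finite V" "y \<in> V" "\<phi> y \<notin> V" "y \<notin> \<phi> ` V"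
  shows "2 * card (indep_sets \<phi> (V - {y})) = card (indep_sets \<phi> V)"
proof -
  have "V - {y} - {z. \<phi> z = y} = V - {y}" using assms(4) by auto
  then show ?thesis
    using card_indep_sets_insert[of "V - {y}" y \<phi>] assms by (simp add: insert_absorb)
qed

text \<open>Let \<open>a\<close> be the count without \<open>y\<close> and \<open>b\<close> the
  count without \<open>y\<close> and its preimage. Restoring the preimage gives
  \<open>a \<le> 2 * b\<close>, while the count on \<open>V\<close> is \<open>a + b\<close>, hence
  at least \<open>3/2 * a\<close>.\<close>

lemma card_indep_sets_remove_top:
  assumes "finite V" "inj \<phi>" "y \<in> V" "\<phi> y \<notin> V"
  shows "3 * card (indep_sets \<phi> (V - {y})) \<le> 2 * card (indep_sets \<phi> V)"
proof -
  define W where "W = V - {y} - {z. \<phi> z = y}"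
  have sub: "card (indep_sets \<phi> (V - {y})) \<le> 2 * card (indep_sets \<phi> W)"
  proof (cases "\<exists>z\<in>V - {y}. \<phi> z = y")
    case True
    then obtain z where z: "z \<in> V - {y}" "\<phi> z = y" by blast
    have "V - {y} = insert z W"
      using z assms(2) by (auto simp: W_def inj_def)
    then show ?thesis
      using card_indep_sets_insert_le[of W \<phi> z] assms(1) by (simp add: W_def)
  next
    case False
    then have "W = V - {y}" by (auto simp: W_def)
    then show ?thesis by simp
  qed
  have "card (indep_sets \<phi> V) = card (indep_sets \<phi> (V - {y})) + card (indep_sets \<phi> W)"
    using card_indep_sets_insert[of "V - {y}" y \<phi>] assms by (simp add: insert_absorb W_def)
  with sub show ?thesis by simp
qed

lemma card_indep_sets_interval_le:
  fixes \<phi> :: "nat \<Rightarrow> nat"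
  assumes inj: "inj \<phi>" and gt: "\<And>y. y > m \<Longrightarrow> \<phi> y > y" and "m \<le> n"
  shows "real (card (indep_sets \<phi> {m<..n})) \<le>
           2 ^ (n - m) * (3/4) ^ card {y. y > m \<and> \<phi> y \<le> n}
                       * (10/9) ^ card {z. z > m \<and> \<phi> (\<phi> z) \<le> n}"
proof -
  have gt_m: "\<phi> y > m" if "y > m" for y
    using gt[OF that] that by simp
  have le: "y \<le> k" if "y > m" "\<phi> y \<le> k" for y k
    using gt[OF that(1)] that(2) by simp
  show ?thesis
    using \<open>m \<le> n\<close>
  proof (induction n rule: dec_induct)
    case base
    have "{y. y > m \<and> \<phi> y \<le> m} = {}" "{z. z > m \<and> \<phi> (\<phi> z) \<le> m} = {}"
      using gt_m by (auto simp: not_le)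
    moreover have "indep_sets \<phi> {} = {{}}" by (auto simp: indep_sets_def)
    ultimately show ?case by (simp only:) simp
  next
    case (step n)
    define A where "A n = {y. y > m \<and> \<phi> y \<le> n}" for n
    define B where "B n = {z. z > m \<and> \<phi> (\<phi> z) \<le> n}" for n
    define V where "V = {m<..n}"
    have finA: "finite (A k)" for k
      by (rule finite_subset[of _ "{..k}"]) (use le in \<open>auto simp: A_def\<close>)
    have finB: "finite (B k)" for k
    proof (rule finite_subset[OF _ finA])
      show "B k \<subseteq> A k"
        using le[OF gt_m] by (auto simp: A_def B_def)
    qed
    have V_Suc: "{m<..Suc n} = insert (Suc n) V"
      using step.hyps by (auto simp: V_def)
    have V: "finite V" "Suc n \<notin> V" "\<phi> (Suc n) \<notin> insert (Suc n) V"
      using gt[of "Suc n"] step.hyps by (auto simp: V_def)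
    let ?c = "\<lambda>V. real (card (indep_sets \<phi> V))"
    let ?P = "\<lambda>n. 2 ^ (n - m) * (3/4) ^ card (A n) * (10/9) ^ card (B n) :: real"
    have IH: "?c V \<le> ?P n" using step.IH by (simp add: A_def B_def V_def)
    \<comment> \<open>The growth factor of the new vertex is 1 plus the proportion of independent
      sets of \<open>V\<close> that avoid its preimage.\<close>
    have split: "?c (insert (Suc n) V) = ?c V + ?c (V - {z. \<phi> z = Suc n})"
      using card_indep_sets_insert[where \<phi> = \<phi>, OF V] by simp
    have pow: "(2::real) ^ (Suc n - m) = 2 * 2 ^ (n - m)"
      using step.hyps by (simp add: Suc_diff_le)
    have "?c (insert (Suc n) V) \<le> ?P (Suc n)"
    proof (cases "\<exists>y>m. \<phi> y = Suc n")
      case False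
      have "A (Suc n) = A n" "B (Suc n) = B n"
        using False gt_m by (auto simp: A_def B_def le_Suc_eq)
      moreover have "V - {z. \<phi> z = Suc n} = V"
        using False by (auto simp: V_def)
      ultimately show ?thesis using split IH pow by simp
    next
      case True
      then obtain y where y: "y > m" "\<phi> y = Suc n" by blast
      have uniq: "\<phi> z = Suc n \<longleftrightarrow> z = y" for z
        using y inj by (metis injD)
      have yV: "y \<in> V" "\<phi> y \<notin> V" using gt[of y] y by (auto simp: V_def)
      have "A (Suc n) = insert y (A n)"
        using y(1) uniq by (auto simp: A_def le_Suc_eq)
      moreover have "y \<notin> A n"
        using y(2) by (simp add: A_def)
      ultimately have cA: "card (A (Suc n)) = Suc (card (A n))" using finA by simp
      have diff: "V - {z. \<phi> z = Suc n} = V - {y}" using uniq by auto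
      show ?thesis
      proof (cases "\<exists>z>m. \<phi> z = y")
        case False
        have "B (Suc n) = B n"
          using False uniq by (auto simp: B_def le_Suc_eq)
        \<comment> \<open>The proportion is 1/2, so the factor is \<open>3/2 = 2 * 3/4\<close>: only
          the first exponent grows.\<close>
        moreover have "2 * ?c (V - {y}) = ?c V"
        proof -
          have "y \<notin> \<phi> ` V" using False by (auto simp: V_def)
          from card_indep_sets_remove_root[OF V(1) yV this] show ?thesis by linarith
        qed
        ultimately show ?thesis using split IH pow cA by (simp add: diff)
      next
        case True
        then obtain z where z: "z > m" "\<phi> z = y" by blast
        have "\<phi> w = y \<longleftrightarrow> w = z" for w
          using z inj by (metis injD)
        then have "B (Suc n) = insert z (B n)"
          using z(1) uniq by (auto simp: B_def le_Suc_eq)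
        moreover have "z \<notin> B n"
          using z(2) y(2) by (simp add: B_def)
        ultimately have cB: "card (B (Suc n)) = Suc (card (B n))" using finB by simp
        \<comment> \<open>The proportion is at most 2/3, so the factor is at most
          \<open>5/3 = 2 * 3/4 * 10/9\<close>: both exponents grow.\<close>
        have "3 * ?c (V - {y}) \<le> 2 * ?c V"
          using card_indep_sets_remove_top[OF V(1) inj yV] by linarith
        then show ?thesis using split IH pow cA cB by (simp add: diff)
      qed
    qed
    then show ?case unfolding V_Suc by (simp add: A_def B_def)
  qed
qed

section \<open>Numerical estimate of the decay rate\<close>

text \<open>The rational bounds on \<open>log 2 (4/3)\<close> and \<open>log 2 (10/9)\<close> must be this sharp: with them, the quadratic
  in \<open>q\<close> to which \<open>decay_rate_less_one\<close> reduces has a barely negative discriminant.\<close>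

lemma ln_four_thirds_ge: "ln (4/3::real) \<ge> 17/41 * ln 2"
proof -
  have "ln ((2::real) ^ 17) \<le> ln ((4/3) ^ 41)"
    by (subst ln_le_cancel_iff) (simp_all add: field_simps)
  then have "17 * ln (2::real) \<le> 41 * ln (4/3)"
    by (simp only: ln_realpow zero_less_numeral zero_less_divide_iff of_nat_numeral simp_thms)
  then show ?thesis by linarith
qed

lemma ln_ten_ninths_le: "ln (10/9::real) \<le> 7/46 * ln 2"
proof -
  have "ln ((10/9::real) ^ 46) \<le> ln (2 ^ 7)"
    by (subst ln_le_cancel_iff) (simp_all add: field_simps)
  then have "46 * ln (10/9::real) \<le> 7 * ln 2"
    by (simp only: ln_realpow zero_less_numeral zero_less_divide_iff of_nat_numeral simp_thms)
  then show ?thesis by linarith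
qed

lemma decay_rate_less_one:
  fixes p q :: nat
  assumes "q > 0"
    and "(q \<ge> 2 \<and> real p > real q * (3 * real q - 2) / (2 * real q - 2)) \<or> (q = 1 \<and> p \<ge> 3)"
  shows "2 * (3/4 * (10/9) powr (1 / real q)) powr (real (p + q) / real q) < 1"
proof -
  define P Q where "P = real p" and "Q = real q"
  have Q: "Q \<ge> 1" using assms(1) by (simp add: Q_def)
  \<comment> \<open>The logarithm of the claim, scaled by \<open>Q\<^sup>2 / ln 2\<close>, with both
    logarithm ratios replaced by their rational bounds.\<close>
  have key: "Q\<^sup>2 < (P + Q) * (17/41 * Q - 7/46)"
    using assms(2)
  proof
    assume "q = 1 \<and> p \<ge> 3"
    \<comment> \<open>Here \<open>P + Q \<ge> 4\<close>, and \<open>17/41 - 7/46\<close> exceeds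
      1/4.\<close>
    then show ?thesis by (simp add: P_def Q_def)
  next
    assume "q \<ge> 2 \<and> real p > real q * (3 * real q - 2) / (2 * real q - 2)"
    then have Q2: "Q \<ge> 2" and "P > Q * (3 * Q - 2) / (2 * Q - 2)"
      by (auto simp: P_def Q_def)
    \<comment> \<open>Clear the denominator and add \<open>Q * (2 * Q - 2)\<close> to both
      sides.\<close>
    then have P: "(P + Q) * (2 * Q - 2) > Q * (5 * Q - 4)"
      by (simp add: field_simps)
    have "Q * (2 * Q - 2) \<le> (5 * Q - 4) * (17/41 * Q - 7/46)"
      \<comment> \<open>The right side minus the left is a quadratic with leading coefficient 3/41
        and vertex 791/276, where its value is still positive.\<close>
      using zero_le_power2[of "Q - 791/276"] by (simp add: power2_eq_square algebra_simps)
    then have "Q * (Q * (2 * Q - 2)) \<le> Q * ((5 * Q - 4) * (17/41 * Q - 7/46))"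
      using Q2 by (intro mult_left_mono) auto
    also have "\<dots> = (Q * (5 * Q - 4)) * (17/41 * Q - 7/46)" by simp
    also have "\<dots> < ((P + Q) * (2 * Q - 2)) * (17/41 * Q - 7/46)"
      using P Q2 by (intro mult_strict_right_mono) auto
    finally have "Q\<^sup>2 * (2 * Q - 2) < (P + Q) * (17/41 * Q - 7/46) * (2 * Q - 2)"
      by (simp add: power2_eq_square mult_ac)
    then show ?thesis using Q2 by (simp add: mult_less_cancel_right)
  qed
  have PQ: "P + Q > 0" using Q by (simp add: P_def)
  have "Q\<^sup>2 * ln 2 < (P + Q) * (17/41 * Q - 7/46) * ln 2"
    using key by simp
  also have "\<dots> = (P + Q) * (Q * (17/41 * ln 2) - 7/46 * ln 2)"
    by (simp add: algebra_simps)
  also have "\<dots> \<le> (P + Q) * (Q * ln (4/3) - ln (10/9))"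
    using PQ Q ln_four_thirds_ge ln_ten_ninths_le
    by (intro mult_left_mono diff_mono) auto
  finally have "ln 2 < (P + Q) * (Q * ln (4/3) - ln (10/9)) / Q\<^sup>2"
    using Q by (simp add: field_simps)
  also have "\<dots> = (P + Q) / Q * (ln (4/3) - ln (10/9) / Q)"
    using Q by (simp add: field_simps power2_eq_square)
  also have "\<dots> = - ((P + Q) / Q * (ln (3/4) + 1 / Q * ln (10/9)))"
    using ln_inverse[of "4/3::real"] by (simp add: algebra_simps)
  finally have "ln 2 + (P + Q) / Q * (ln (3/4) + 1 / Q * ln (10/9)) < 0"
    by simp
  moreover have "ln (2 * (3/4 * (10/9) powr (1 / Q)) powr ((P + Q) / Q)) =
      ln 2 + (P + Q) / Q * (ln (3/4) + 1 / Q * ln (10/9))"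
    by (simp add: ln_mult ln_powr del: times_divide_eq_left)
  ultimately have "ln (2 * (3/4 * (10/9) powr (1 / Q)) powr ((P + Q) / Q)) < 0" by simp
  then show ?thesis by (simp add: P_def Q_def)
qed

section \<open>Sets with a prescribed least element\<close>

text \<open>If \<open>k\<close> edges start above \<open>m\<close> and end by \<open>n\<close>, at
  most \<open>k div q\<close> vertices start a path of two edges. Each edge thus costs a factor
  \<open>\<rho>\<close> on average, and \<open>k\<close> is at least
  \<open>(p + q) / q * (n div (p + q) - m) - 1\<close>.\<close>

lemma card_indep_sets_affine_le:
  fixes p q m n :: nat
  assumes p: "p > 0" and q: "q > 0" and m: "m > 0" "m \<le> n div (p + q)"
  defines "\<rho> \<equiv> 3/4 * (10/9) powr (1 / real q)"
  shows "real (card (indep_sets (\<lambda>y. q * y + p * m) {m<..n})) \<le>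
           2 ^ (n - n div (p + q)) / \<rho> *
           (2 * \<rho> powr (real (p + q) / real q)) ^ (n div (p + q) - m)"
proof -
  define \<phi> where "\<phi> y = q * y + p * m" for y
  define N where "N = n div (p + q)"
  define k where "k = (n - p * m) div q - m"
  have N: "N * (p + q) \<le> n" "m \<le> N" using m by (auto simp: N_def)
  \<comment> \<open>This keeps the natural-number subtractions in \<open>k\<close> from
    truncating.\<close>
  have pqm: "p * m + q * m + (p + q) * (N - m) \<le> n"
    using N by (simp add: algebra_simps flip: distrib_left)
  have mn: "m \<le> n" using m q by (meson div_le_dividend order_trans)
  have "inj \<phi>" using q by (auto simp: inj_def \<phi>_def)
  moreover have "\<phi> y > y" for y
  proof -
    have "1 * y \<le> q * y" using q by (intro mult_right_mono) auto
    moreover have "0 < p * m" using p m by simp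
    ultimately show ?thesis unfolding \<phi>_def by linarith
  qed
  ultimately have le: "real (card (indep_sets \<phi> {m<..n})) \<le>
      2 ^ (n - m) * (3/4) ^ card {y. y > m \<and> \<phi> y \<le> n}
                  * (10/9) ^ card {z. z > m \<and> \<phi> (\<phi> z) \<le> n}"
    using mn by (rule card_indep_sets_interval_le)
  have mk: "(n - p * m) div q = m + k"
  proof -
    have "m \<le> (n - p * m) div q"
      using pqm q by (simp add: less_eq_div_iff_mult_less_eq mult.commute)
    then show ?thesis by (simp add: k_def)
  qed
  have \<phi>_le: "\<phi> y \<le> n \<longleftrightarrow> y \<le> m + k" for y
    unfolding mk[symmetric] \<phi>_def using pqm q
    by (simp add: less_eq_div_iff_mult_less_eq mult.commute le_diff_conv2)
  have "{y. y > m \<and> \<phi> y \<le> n} = {m<..m+k}"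
    by (intro set_eqI) (simp add: \<phi>_le)
  then have cA: "card {y. y > m \<and> \<phi> y \<le> n} = k" by simp
  have "{z. z > m \<and> \<phi> (\<phi> z) \<le> n} \<subseteq> {m<..m + k div q}"
  proof
    fix z assume "z \<in> {z. z > m \<and> \<phi> (\<phi> z) \<le> n}"
    then have z: "z > m" "q * z + p * m \<le> m + k" by (auto simp: \<phi>_le) (simp add: \<phi>_def)
    \<comment> \<open>The shift \<open>p * m\<close> absorbs the \<open>m\<close> in
      \<open>m + k\<close>, so \<open>z\<close> is compared with \<open>k\<close> alone.\<close>
    have "m \<le> p * m" using p by simp
    with z(2) have "q * z \<le> k" by linarith
    then have "q * (z - m) \<le> k" by (simp add: diff_mult_distrib2)
    then have "z - m \<le> k div q" using q by (simp add: less_eq_div_iff_mult_less_eq mult.commute)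
    with z show "z \<in> {m<..m + k div q}" by auto
  qed
  from card_mono[OF _ this] have cB: "card {z. z > m \<and> \<phi> (\<phi> z) \<le> n} \<le> k div q" by simp
  \<comment> \<open>With \<open>\<rho> < 1\<close>, a lower bound on \<open>k\<close> becomes an
    upper bound on \<open>\<rho> ^ k\<close>.\<close>
  have \<rho>: "0 < \<rho>" "\<rho> < 1"
  proof -
    have "(10/9::real) powr (1 / real q) \<le> (10/9) powr 1"
      using q by (intro powr_mono) auto
    then show "\<rho> < 1" by (simp add: \<rho>_def)
  qed (simp add: \<rho>_def)
  have "(10/9::real) ^ card {z. z > m \<and> \<phi> (\<phi> z) \<le> n} \<le> (10/9) ^ (k div q)"
    using cB by (intro power_increasing) auto
  also have "\<dots> = (10/9) powr real (k div q)"
    by (simp add: powr_realpow)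
  also have "\<dots> \<le> (10/9) powr (real k / real q)"
    by (intro powr_mono) (simp_all add: field_char_0_class.of_nat_div divide_right_mono)
  also have "\<dots> = ((10/9) powr (1 / real q)) ^ k"
    by (simp add: powr_realpow[symmetric] powr_powr)
  finally have "(3/4::real) ^ k * (10/9) ^ card {z. z > m \<and> \<phi> (\<phi> z) \<le> n} \<le> \<rho> ^ k"
    unfolding \<rho>_def power_mult_distrib by (intro mult_left_mono) auto
  then have "2 ^ (n - m) * ((3/4::real) ^ k * (10/9) ^ card {z. z > m \<and> \<phi> (\<phi> z) \<le> n})
               \<le> 2 ^ (n - m) * \<rho> ^ k"
    by (intro mult_left_mono) auto
  with le have "real (card (indep_sets \<phi> {m<..n})) \<le> 2 ^ (n - m) * \<rho> ^ k"
    unfolding cA mult.assoc by (rule order_trans)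
  \<comment> \<open>Rounding down in \<open>k\<close> loses less than one edge, which accounts for
    the division by \<open>\<rho>\<close>.\<close>
  also have "\<rho> ^ k \<le> (\<rho> powr (real (p + q) / real q)) ^ (N - m) / \<rho>"
  proof -
    have "(p + q) * (N - m) \<le> n - p * m - q * m" using pqm by simp
    also have "\<dots> < q * (k + 1)"
    proof -
      have "n - p * m < q * ((n - p * m) div q + 1)"
        using dividend_less_times_div[OF q] by simp
      then have "n - p * m < q * m + q * (k + 1)"
        unfolding mk by (simp add: algebra_simps)
      moreover have "0 < q * (k + 1)" using q by simp
      ultimately show ?thesis by linarith
    qed
    finally have "real ((p + q) * (N - m)) < real (q * (k + 1))" by (simp only: of_nat_less_iff)
    then have "real (p + q) / real q * real (N - m) - 1 \<le> real k"
      using q by (simp add: field_simps)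
    then have "\<rho> powr real k \<le> \<rho> powr (real (p + q) / real q * real (N - m) - 1)"
      using \<rho> by (intro powr_mono') auto
    also have "\<dots> = (\<rho> powr (real (p + q) / real q)) ^ (N - m) / \<rho>"
      using \<rho> by (simp add: powr_diff powr_powr flip: powr_realpow)
    finally show ?thesis using \<rho> by (simp add: powr_realpow)
  qed
  also have "(2::real) ^ (n - m) = 2 ^ (n - N) * 2 ^ (N - m)"
  proof -
    have "N \<le> n" by (simp add: N_def)
    then show ?thesis using N(2) by (simp flip: power_add)
  qed
  finally show ?thesis
    by (simp add: \<phi>_def[abs_def] N_def power_mult_distrib mult_ac)
qed

text \<open>Take \<open>m = Min S\<close> and use only the solutions with \<open>x = m\<close>.
  Discarding the other constraints makes this an inclusion, which is enough for an upper
  bound.\<close>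

lemma free_subsets_cover:
  "free_subsets p q n \<subseteq> Pow {M<..n} \<union>
     (\<Union>m\<in>{1..M}. insert m ` indep_sets (\<lambda>y. q * y + p * m) {m<..n})"
proof
  fix S assume "S \<in> free_subsets p q n"
  then have S: "S \<subseteq> {1..n}" "lin_free p q S" by (auto simp: free_subsets_def)
  then have fin: "finite S" using finite_subset by blast
  show "S \<in> Pow {M<..n} \<union> (\<Union>m\<in>{1..M}. insert m ` indep_sets (\<lambda>y. q * y + p * m) {m<..n})"
  proof (cases "S \<subseteq> {M<..n}")
    case True
    then show ?thesis by blast
  next
    case False
    define m where "m = Min S"
    from False S(1) obtain x where x: "x \<in> S" "x \<le> M" by fastforce
    then have m: "m \<in> S" and min: "\<And>y. y \<in> S \<Longrightarrow> m \<le> y"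
      using fin Min_in by (auto simp: m_def)
    have "m \<in> {1..M}" using m S(1) min[OF x(1)] x(2) by auto
    moreover have "S - {m} \<in> indep_sets (\<lambda>y. q * y + p * m) {m<..n}"
    proof -
      have "S - {m} \<subseteq> {m<..n}" using S(1) min by (fastforce intro: le_neq_implies_less)
      moreover have "q * y + p * m \<notin> S" if "y \<in> S" for y
        using S(2) m that unfolding lin_free_def by (metis add.commute)
      ultimately show ?thesis by (auto simp: indep_sets_def)
    qed
    moreover have "S = insert m (S - {m})" using m by auto
    ultimately show ?thesis by blast
  qed
qed

section \<open>Largest solution-free sets\<close>

lemma finite_free_subsets: "finite (free_subsets p q n)"
  by (rule finite_subset[of _ "Pow {1..n}"]) (auto simp: free_subsets_def)

lemma lin_free_subset: "lin_free p q A \<Longrightarrow> B \<subseteq> A \<Longrightarrow> lin_free p q B"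
  unfolding lin_free_def by blast

lemma mu_free_ge:
  assumes "A \<in> free_subsets p q n"
  shows "card A \<le> mu_free p q n"
  unfolding mu_free_def using assms finite_free_subsets by (intro Max_ge) auto

text \<open>For \<open>x\<close> and \<open>y\<close> above \<open>n div (p + q)\<close>, the value
  \<open>p * x + q * y\<close> is at least \<open>(p + q) * (n div (p + q) + 1)\<close>, which
  exceeds \<open>n\<close>.\<close>

lemma mu_free_ge_interval:
  assumes "p + q > 0"
  shows "n - n div (p + q) \<le> mu_free p q n"
proof -
  let ?M = "n div (p + q)"
  have "lin_free p q {?M<..n}"
  proof -
    have "p * x + q * y > n" if "x > ?M" "y > ?M" for x y
    proof -
      have "n < (p + q) * (?M + 1)"
        using dividend_less_times_div[OF assms] by simp
      also have "\<dots> = p * (?M + 1) + q * (?M + 1)" by (rule distrib_right)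
      also have "\<dots> \<le> p * x + q * y" using that by (intro add_mono mult_left_mono) auto
      finally show ?thesis .
    qed
    then show ?thesis unfolding lin_free_def by fastforce
  qed
  then have "{?M<..n} \<in> free_subsets p q n" by (auto simp: free_subsets_def)
  from mu_free_ge[OF this] show ?thesis by simp
qed

text \<open>All subsets of a largest solution-free set are solution-free.\<close>

lemma two_power_mu_free_le: "2 ^ mu_free p q n \<le> num_free p q n"
proof -
  have "{} \<in> free_subsets p q n" by (auto simp: free_subsets_def lin_free_def)
  then have "mu_free p q n \<in> card ` free_subsets p q n"
    unfolding mu_free_def using finite_free_subsets by (intro Max_in) auto
  then obtain A where A: "A \<in> free_subsets p q n" "mu_free p q n = card A" by blast
  then have "Pow A \<subseteq> free_subsets p q n"
    using lin_free_subset by (fastforce simp: free_subsets_def)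
  from card_mono[OF finite_free_subsets this] have "card (Pow A) \<le> num_free p q n"
    by (simp add: num_free_def)
  moreover have "finite A" using A(1) finite_subset by (auto simp: free_subsets_def)
  ultimately show ?thesis using A(2) by (simp add: card_Pow)
qed

section \<open>Summation over the least element\<close>

lemma num_free_le:
  fixes p q :: nat
  assumes p: "p > 0" and q: "q > 0"
    and pq: "(q \<ge> 2 \<and> real p > real q * (3 * real q - 2) / (2 * real q - 2)) \<or> (q = 1 \<and> p \<ge> 3)"
  shows "\<exists>C. \<forall>n. real (num_free p q n) \<le> C * 2 ^ mu_free p q n"
proof -
  define \<rho> where "\<rho> = 3/4 * (10/9) powr (1 / real q)"
  define \<sigma> where "\<sigma> = 2 * \<rho> powr (real (p + q) / real q)"
  have \<rho>: "\<rho> > 0" by (simp add: \<rho>_def)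
  have \<sigma>: "0 < \<sigma>" "\<sigma> < 1"
    using decay_rate_less_one[OF q pq] \<rho> by (simp_all add: \<sigma>_def \<rho>_def)
  \<comment> \<open>The 1 counts the subsets of the upper interval; the other term bounds the
    geometric series over the least elements \<open>m \<le> n div (p + q)\<close>.\<close>
  define C where "C = 1 + 1 / \<rho> * (1 / (1 - \<sigma>))"
  have C: "C > 0" using \<rho> \<sigma> by (simp add: C_def add_pos_pos)
  have "real (num_free p q n) \<le> C * 2 ^ mu_free p q n" for n
  proof -
    let ?M = "n div (p + q)"
    let ?I = "\<lambda>m. indep_sets (\<lambda>y. q * y + p * m) {m<..n}"
    have "num_free p q n \<le> card (Pow {?M<..n} \<union> (\<Union>m\<in>{1..?M}. insert m ` ?I m))"
      unfolding num_free_def by (intro card_mono free_subsets_cover) auto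
    also have "\<dots> \<le> card (Pow {?M<..n}) + card (\<Union>m\<in>{1..?M}. insert m ` ?I m)"
      by (rule card_Un_le)
    also have "card (\<Union>m\<in>{1..?M}. insert m ` ?I m) \<le> (\<Sum>m\<in>{1..?M}. card (insert m ` ?I m))"
      by (rule card_UN_le) simp
    also have "\<dots> \<le> (\<Sum>m\<in>{1..?M}. card (?I m))"
      by (intro sum_mono card_image_le) simp
    finally have "num_free p q n \<le> 2 ^ (n - ?M) + (\<Sum>m\<in>{1..?M}. card (?I m))"
      by (simp add: card_Pow)
    then have "real (num_free p q n) \<le> real (2 ^ (n - ?M) + (\<Sum>m\<in>{1..?M}. card (?I m)))"
      by (simp only: of_nat_le_iff)
    also have "\<dots> = 2 ^ (n - ?M) + (\<Sum>m\<in>{1..?M}. real (card (?I m)))"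
      by simp
    also have "(\<Sum>m\<in>{1..?M}. real (card (?I m)))
                 \<le> (\<Sum>m\<in>{1..?M}. 2 ^ (n - ?M) / \<rho> * \<sigma> ^ (?M - m))"
      using card_indep_sets_affine_le[OF p q] unfolding \<sigma>_def \<rho>_def
      by (intro sum_mono) auto
    also have "\<dots> = 2 ^ (n - ?M) / \<rho> * (\<Sum>j<?M. \<sigma> ^ j)"
    proof -
      have "(\<Sum>m\<in>{1..?M}. \<sigma> ^ (?M - m)) = (\<Sum>j<?M. \<sigma> ^ j)"
        by (rule sum.reindex_bij_witness[of _ "\<lambda>j. ?M - j" "\<lambda>m. ?M - m"]) auto
      then show ?thesis by (simp only: flip: sum_distrib_left)
    qed
    also have "\<dots> \<le> 2 ^ (n - ?M) / \<rho> * (1 / (1 - \<sigma>))"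
    proof -
      have "(\<Sum>j<?M. \<sigma> ^ j) = (1 - \<sigma> ^ ?M) / (1 - \<sigma>)"
        using \<sigma> by (simp add: sum_gp_strict)
      also have "\<dots> \<le> 1 / (1 - \<sigma>)" using \<sigma> by (intro divide_right_mono) auto
      finally show ?thesis using \<rho> by (intro mult_left_mono) auto
    qed
    finally have "real (num_free p q n) \<le> C * 2 ^ (n - ?M)"
      by (simp add: C_def algebra_simps)
    also have "\<dots> \<le> C * 2 ^ mu_free p q n"
      using C mu_free_ge_interval[of p q n] p by (intro mult_left_mono power_increasing) auto
    finally show ?thesis .
  qed
  then show ?thesis by blast
qed

theorem theorem3:
  fixes p q :: nat
  assumes "p > 0" and "q > 0"
    and "(q \<ge> 2 \<and> real p > real q * (3 * real q - 2) / (2 * real q - 2)) \<or> (q = 1 \<and> p \<ge> 3)"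
  shows "(\<lambda>n. real (num_free p q n)) \<in> \<Theta>[at_top](\<lambda>n. 2 ^ mu_free p q n)"
proof -
  obtain C where C: "\<And>n. real (num_free p q n) \<le> C * 2 ^ mu_free p q n"
    using num_free_le[OF assms] by blast
  have "real (2 ^ mu_free p q n) \<le> real (num_free p q n)" for n
    using two_power_mu_free_le by (simp only: of_nat_le_iff)
  then have "(\<lambda>n. 2 ^ mu_free p q n) \<in> O(\<lambda>n. real (num_free p q n))"
    by (intro bigoI[where c = 1]) auto
  moreover have "(\<lambda>n. real (num_free p q n)) \<in> O(\<lambda>n. 2 ^ mu_free p q n)"
    using C by (intro bigoI[where c = C]) auto
  ultimately show ?thesis by (simp add: bigtheta_def bigomega_iff_bigo)
qed

end
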